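(* Let $d,k,n$ be positive integers with $k\geq4$ and $d\geq k-1$. Write $q=\lfloor n/d\rfloor$ and $r=n\bmod d$. (1) If $n\leq d$, then $\mathrm{gp}^k_d(P_n\,\Box\,P_2)=2\min(n,k-2)$ if $1\leq n\leq 2k-4$, and $\mathrm{gp}^k_d(P_n\,\Box\,P_2)=2k-3$ if $n\geq 2k-3$. (2) If $n\geq d+1$ and $d<2k-3$, then $\mathrm{gp}^k_d(P_n\,\Box\,P_2)=(2k-4)q+2\min(r,k-2)$. (3) Suppose $n\geq d+1$ and $d\geq 2k-3$. (a) If $r\leq k-2$: if $r\leq q$ then $\mathrm{gp}^k_d(P_n\,\Box\,P_2)=(2k-3)q+r$; if $r>q$ then $\mathrm{gp}^k_d(P_n\,\Box\,P_2)=(2k-4)q+2r$. (b) If $k-2<r<2k-3$: if $2k-4-r\leq q$ then $\mathrm{gp}^k_d(P_n\,\Box\,P_2)=(2k-3)q+r$; if $2k-4-r>q$ then $\mathrm{gp}^k_d(P_n\,\Box\,P_2)=(2k-4)(q+1)$. (c) If $r\geq 2k-3$, then $\mathrm{gp}^k_d(P_n\,\Box\,P_2)=(2k-3)(q+1)$.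
   Context: $P_n\,\Box\,P_2$ is the grid with vertex set $\{1,\ldots,n\}\times\{1,2\}$, where $(i,j)$ and $(i',j')$ are adjacent iff either $j=j'$ and $|i-i'|=1$, or $i=i'$ and $j\neq j'$. For a graph $G$, a geodesic is a shortest path between two vertices; its length $\lambda(g)$ is its number of edges. For $d\ge1$, $k\ge2$, $S\subseteq V(G)$ is a $k$-general $d$-position set if every geodesic $g$ with $|S\cap V(g)|\geq k$ has $\lambda(g)>d$; $\mathrm{gp}^k_d(G)$ is the largest cardinality of such a set. *)

theory Defs
  imports "Graph_Theory.Graph_Theory"
begin

text \<open>
  Graphs are symmetric loop-free digraphs in the sense of Graph_Theory, so each undirected edge
  appears as two opposite arcs. A path is given by its list of vertices p: its vertex set is
  set p, and \<^const>\<open>vwalk_length\<close> counts its edges.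
\<close>

definition grid2 :: "nat \<Rightarrow> (nat \<times> nat) pair_pre_digraph" where
  "grid2 n = \<lparr> pverts = {1..n} \<times> {1, 2},
     parcs = {((i, j), (i', j')).
       (i, j) \<in> {1..n} \<times> {1, 2} \<and> (i', j') \<in> {1..n} \<times> {1, 2} \<and>
       (j = j' \<and> \<bar>int i - int i'\<bar> = 1 \<or> i = i' \<and> j \<noteq> j')} \<rparr>"

lemma graph_grid2: "pair_graph (grid2 n)"
proof
  show "fst e \<in> pverts (grid2 n)" "snd e \<in> pverts (grid2 n)" "fst e \<noteq> snd e"
    if "e \<in> parcs (grid2 n)" for e
    using that by (auto simp: grid2_def)
  have "parcs (grid2 n) \<subseteq> ({1..n} \<times> {1, 2}) \<times> ({1..n} \<times> {1, 2})"
    by (auto simp: grid2_def)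
  then show "finite (parcs (grid2 n))"
    by (rule finite_subset) simp
  show "finite (pverts (grid2 n))"
    by (simp add: grid2_def)
  show "symmetric (with_proj (grid2 n))"
    unfolding symmetric_def with_proj_simps
  proof (rule symI)
    fix x y
    assume "(x, y) \<in> parcs (grid2 n)"
    then show "(y, x) \<in> parcs (grid2 n)"
      by (cases x, cases y) (simp add: grid2_def, arith)
  qed
qed

definition geodesic :: "('a, 'b) pre_digraph \<Rightarrow> 'a list \<Rightarrow> bool" where
  "geodesic G p \<longleftrightarrow> vpath p G \<and>
     (\<forall>p'. vpath p' G \<and> hd p' = hd p \<and> last p' = last p \<longrightarrow> vwalk_length p \<le> vwalk_length p')"

definition general_position_set ::
    "nat \<Rightarrow> nat \<Rightarrow> ('a, 'b) pre_digraph \<Rightarrow> 'a set \<Rightarrow> bool" where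
  "general_position_set k d G S \<longleftrightarrow> S \<subseteq> verts G \<and>
     (\<forall>p. geodesic G p \<and> card (S \<inter> set p) \<ge> k \<longrightarrow> vwalk_length p > d)"

definition gp :: "nat \<Rightarrow> nat \<Rightarrow> ('a, 'b) pre_digraph \<Rightarrow> nat" where
  "gp k d G = Max (card ` {S. general_position_set k d G S})"

text \<open>The maximum is attained on every finite graph.\<close>

lemma finite_general_position_sets:
  "finite (verts G) \<Longrightarrow> finite {S. general_position_set k d G S}"
  by (rule finite_subset[of _ "Pow (verts G)"]) (auto simp: general_position_set_def)

lemma general_position_set_empty: "k \<ge> 1 \<Longrightarrow> general_position_set k d G {}"
  by (simp add: general_position_set_def)

end

theory Submission
  imports Defs
begin

text \<open>
  A geodesic of the ladder is monotone and changes rows at most once. So \<open>S\<close> is in general position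
  iff each row meets \<open>d + 1\<close> consecutive columns in fewer than \<open>k\<close> points of \<open>S\<close>, and likewise each
  path through \<open>d\<close> consecutive columns that changes rows at some column \<open>c\<close>. Adding the two row-changing
  paths through \<open>c\<close> bounds the weight of a window of \<open>d\<close> columns plus the weight of \<open>c\<close> by \<open>2 * k - 2\<close>;
  all upper bounds follow by cutting the ladder into windows. They are attained by taking
  either \<open>k - 2\<close> full columns per period \<open>d\<close>, or \<open>2 * k - 3\<close> columns per period with one vertex
  each, the rows alternating.
\<close>

section \<open>Reversal of walks and geodesics\<close>

lemma set_vwalk_arcs_rev: "set (vwalk_arcs (rev p)) = (set (vwalk_arcs p))\<inverse>"
proof (induction p rule: vwalk_arcs.induct)
  case (3 x y xs)
  have "vwalk_arcs (rev (x # y # xs)) = vwalk_arcs (rev (y # xs) @ [x])"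
    by simp
  also have "\<dots> = vwalk_arcs (rev (y # xs)) @ [(y, x)]"
    by (subst vwalk_arcs_append) (auto simp: last_rev)
  finally show ?case
    using 3 by auto
qed auto

lemma vpath_rev:
  assumes "symmetric G" and "vpath p G"
  shows "vpath (rev p) G"
  using assms unfolding vpath_def vwalk_def set_vwalk_arcs_rev symmetric_def
  by (auto dest: symD)

text \<open>Allows every geodesic to be read from left to right.\<close>

lemma geodesic_rev:
  assumes "symmetric G" and "geodesic G p"
  shows "geodesic G (rev p)"
  unfolding geodesic_def
proof (intro conjI allI impI)
  show "vpath (rev p) G"
    using assms by (simp add: vpath_rev geodesic_def)
  fix p' assume p': "vpath p' G \<and> hd p' = hd (rev p) \<and> last p' = last (rev p)"
  have "p \<noteq> []" "p' \<noteq> []"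
    using assms p' by (auto simp: geodesic_def vpath_def vwalk_def)
  then have "vpath (rev p') G" "hd (rev p') = hd p" "last (rev p') = last p"
    using p' assms(1) by (auto simp: vpath_rev hd_rev last_rev)
  then have "vwalk_length p \<le> vwalk_length (rev p')"
    using assms(2) by (auto simp: geodesic_def)
  then show "vwalk_length (rev p) \<le> vwalk_length p'"
    by simp
qed

section \<open>Distances and geodesics in the ladder\<close>

abbreviation grid :: "nat \<Rightarrow> (nat \<times> nat, (nat \<times> nat) \<times> (nat \<times> nat)) pre_digraph" where
  "grid n \<equiv> with_proj (grid2 n)"

lemma symmetric_grid: "symmetric (grid n)"
proof -
  interpret pair_graph "grid2 n"
    by (rule graph_grid2)
  show ?thesis
    by (rule sym_arcs)
qed

text \<open>The graph distance of the ladder in closed form, as an integer so that differences of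
  columns are not truncated.\<close>

definition grid_dist :: "nat \<times> nat \<Rightarrow> nat \<times> nat \<Rightarrow> int" where
  "grid_dist x y = \<bar>int (fst x) - int (fst y)\<bar> + of_bool (snd x \<noteq> snd y)"

lemma grid_dist_step:
  assumes "(u, v) \<in> parcs (grid2 n)"
  shows "grid_dist u w \<le> 1 + grid_dist v w"
proof -
  have "snd u = snd v \<and> \<bar>int (fst u) - int (fst v)\<bar> = 1 \<or> fst u = fst v \<and> snd u \<noteq> snd v"
    using assms by (auto simp: grid2_def)
  then show ?thesis
    unfolding grid_dist_def by (elim disjE conjE) (simp_all add: of_bool_def)
qed

text \<open>One arc changes the distance to the endpoint by at most one, so induction along the walk
  gives the lower bound on its length.\<close>

lemma grid_dist_le:
  assumes "vwalk p (grid n)"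
  shows "grid_dist (hd p) (last p) \<le> int (vwalk_length p)"
  using assms
proof (induction p rule: vwalk_induct)
  case (Cons u v es)
  have "grid_dist u (last (v # es)) \<le> 1 + grid_dist v (last (v # es))"
    using Cons(1) by (intro grid_dist_step) simp
  then show ?case
    using Cons(2) by simp
qed (simp add: grid_dist_def)

definition strip :: "nat \<Rightarrow> nat \<Rightarrow> nat \<Rightarrow> (nat \<times> nat) list" where
  "strip j a b = map (\<lambda>i. (i, j)) [a..<Suc b]"

lemma strip_simps:
  assumes "a \<le> b"
  shows "strip j a b \<noteq> []" "hd (strip j a b) = (a, j)" "last (strip j a b) = (b, j)"
    "set (strip j a b) = {a..b} \<times> {j}" "distinct (strip j a b)"
    "length (strip j a b) = Suc b - a"
proof -
  have [simp]: "[a..<Suc b] \<noteq> []"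
    using assms by simp
  show "strip j a b \<noteq> []" "distinct (strip j a b)" "length (strip j a b) = Suc b - a"
    using assms by (simp_all add: strip_def distinct_map inj_on_def del: upt_Suc)
  show "hd (strip j a b) = (a, j)" "last (strip j a b) = (b, j)"
    unfolding strip_def using assms by (simp_all add: hd_map last_map hd_upt last_upt del: upt_Suc)
  show "set (strip j a b) = {a..b} \<times> {j}"
    unfolding strip_def by (auto simp del: upt_Suc)
qed

lemma vwalk_append:
  assumes "vwalk p G" "vwalk q G" "(last p, hd q) \<in> arcs_ends G"
  shows "vwalk (p @ q) G"
  using assms by (auto simp: vwalk_def vwalk_arcs_append)

lemma vwalk_strip:
  assumes "1 \<le> a" "a \<le> b" "b \<le> n" "j \<in> {1, 2}"
  shows "vwalk (strip j a b) (grid n)"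
  using assms(2,3)
proof (induction b rule: dec_induct)
  case base
  then show ?case
    using assms by (auto simp: strip_def vwalk_def grid2_def)
next
  case (step b)
  have eq: "strip j a (Suc b) = strip j a b @ [(Suc b, j)]"
    using step by (simp add: strip_def)
  show ?case
    unfolding eq
  proof (rule vwalk_append)
    show "vwalk (strip j a b) (grid n)"
      using step by simp
    show "vwalk [(Suc b, j)] (grid n)"
      using assms step by (auto simp: vwalk_def grid2_def)
    show "(last (strip j a b), hd [(Suc b, j)]) \<in> arcs_ends (grid n)"
      using assms step by (auto simp: strip_simps grid2_def)
  qed
qed

lemma geodesicI_grid:
  assumes "vwalk p (grid n)" "distinct p"
    and "int (vwalk_length p) \<le> grid_dist (hd p) (last p)"
  shows "geodesic (grid n) p"
  unfolding geodesic_def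
proof (intro conjI allI impI)
  show "vpath p (grid n)"
    using assms by (simp add: vpath_def)
  fix p' assume p': "vpath p' (grid n) \<and> hd p' = hd p \<and> last p' = last p"
  then show "vwalk_length p \<le> vwalk_length p'"
    using assms(3) grid_dist_le[of p' n] by (auto simp: vpath_def)
qed

lemma geodesic_strip:
  assumes "1 \<le> a" "a \<le> b" "b \<le> n" "j \<in> {1, 2}"
  shows "geodesic (grid n) (strip j a b)"
  using assms by (intro geodesicI_grid vwalk_strip) (auto simp: strip_simps grid_dist_def)

text \<open>The two strips share column \<open>c\<close>; the vertical edge joining them there is
  what the \<open>of_bool\<close> term of \<open>grid_dist\<close> accounts for.\<close>

lemma geodesic_strip_append:
  assumes "1 \<le> a" "a \<le> c" "c \<le> b" "b \<le> n" "j \<in> {1, 2}" "j' \<in> {1, 2}" "j \<noteq> j'"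
  shows "geodesic (grid n) (strip j a c @ strip j' c b)"
proof (rule geodesicI_grid)
  show "vwalk (strip j a c @ strip j' c b) (grid n)"
    using assms
    by (intro vwalk_append vwalk_strip) (auto simp: strip_simps grid2_def)
  show "distinct (strip j a c @ strip j' c b)"
    using assms by (auto simp: strip_simps)
  show "int (vwalk_length (strip j a c @ strip j' c b))
      \<le> grid_dist (hd (strip j a c @ strip j' c b)) (last (strip j a c @ strip j' c b))"
    using assms by (auto simp: strip_simps grid_dist_def)
qed

text \<open>Compare with an explicit path between the same ends: a single strip, or, if the rows
  differ, the path that changes rows at once in its first column.\<close>

lemma geodesic_length_le:
  assumes p: "geodesic (grid n) p" and le: "fst (hd p) \<le> fst (last p)"
  shows "int (vwalk_length p) \<le> grid_dist (hd p) (last p)"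
proof -
  obtain a j b j' where ab: "hd p = (a, j)" "last p = (b, j')"
    by fastforce
  have ne: "p \<noteq> []" and "set p \<subseteq> {1..n} \<times> {1, 2}"
    using p by (auto simp: geodesic_def vpath_def vwalk_def grid2_def)
  then have "hd p \<in> {1..n} \<times> {1, 2}" "last p \<in> {1..n} \<times> {1, 2}"
    using hd_in_set last_in_set by blast+
  then have bounds: "1 \<le> a" "b \<le> n" "j \<in> {1, 2}" "j' \<in> {1, 2}"
    by (auto simp: ab)
  have ab_le: "a \<le> b"
    using le ab by simp
  show ?thesis
  proof (cases "j = j'")
    case True
    have "vpath (strip j a b) (grid n)"
      using geodesic_strip[of a b n j] bounds ab_le by (auto simp: geodesic_def)
    then have "vwalk_length p \<le> vwalk_length (strip j a b)"
      using p ab True ab_le by (auto simp: geodesic_def strip_simps simp del: vwalk_length_simp)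
    then show ?thesis
      using ab_le True by (auto simp: ab strip_simps grid_dist_def)
  next
    case False
    have "vpath (strip j a a @ strip j' a b) (grid n)"
      using geodesic_strip_append[of a a b n j j'] bounds ab_le False by (auto simp: geodesic_def)
    then have "vwalk_length p \<le> vwalk_length (strip j a a @ strip j' a b)"
      using p ab ab_le by (auto simp: geodesic_def strip_simps simp del: vwalk_length_simp)
    then show ?thesis
      using ab_le False by (auto simp: ab strip_simps grid_dist_def)
  qed
qed

text \<open>Every step of such a walk must bring it closer to its end. Hence it never moves left,
  and a vertical step is possible only into the row of the last vertex. The witness \<open>c\<close>
  is the column of the row change, if there is one.\<close>

lemma tight_vwalk_cover:
  assumes "vwalk p (grid n)" "fst (hd p) \<le> fst (last p)"
    and "int (vwalk_length p) \<le> grid_dist (hd p) (last p)"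
  shows "\<exists>c. fst (hd p) \<le> c \<and> c \<le> fst (last p) \<and>
    set p \<subseteq> {fst (hd p)..c} \<times> {snd (hd p)} \<union> {c..fst (last p)} \<times> {snd (last p)}"
  using assms
proof (induction p rule: list.induct)
  case (Cons u es)
  show ?case
  proof (cases es)
    case Nil
    then show ?thesis
      by (cases u) (auto intro!: exI[of _ "fst u"])
  next
    case (Cons v es')
    obtain a j a' j' b l where uv: "u = (a, j)" "v = (a', j')" "last es = (b, l)"
      by fastforce
    have es: "es \<noteq> []" "hd es = v"
      using Cons by auto
    have walk: "vwalk es (grid n)" and arc: "(u, v) \<in> parcs (grid2 n)"
      using Cons.prems(1) es by (auto elim: vwalk_consE)
    have len: "int (vwalk_length (u # es)) = 1 + int (vwalk_length es)"
      using Cons by simp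
    have dist: "grid_dist v (b, l) \<le> int (vwalk_length es)"
      using grid_dist_le[OF walk] es uv by simp
    have tight: "1 + int (vwalk_length es) \<le> grid_dist u (b, l)"
    proof -
      have "last (u # es) = (b, l)"
        using es uv(3) by simp
      then show ?thesis
        using Cons.prems(3) len by (simp only: list.sel(1))
    qed
    have ab: "a \<le> b"
      using Cons.prems(2) es uv by simp
    have step: "j = j' \<and> \<bar>int a - int a'\<bar> = 1 \<or> a = a' \<and> j \<noteq> j'"
      using arc by (auto simp: uv grid2_def)
    \<comment> \<open>Overshooting column \<open>b\<close> is possible only from
      \<open>a = b\<close>, and then the distance to the end would grow.\<close>
    have a'b: "a' \<le> b"
      using step dist tight ab by (auto simp: uv grid_dist_def)
    have "int (vwalk_length es) \<le> grid_dist v (b, l)"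
      using tight grid_dist_step[OF arc, of "(b, l)"] by linarith
    then obtain c where c: "a' \<le> c" "c \<le> b" "set es \<subseteq> {a'..c} \<times> {j'} \<union> {c..b} \<times> {l}"
      using Cons.IH[OF walk] a'b by (auto simp: es uv)
    show ?thesis
    proof (cases "j = j'")
      case True
      then have "a' = Suc a"
        using step dist tight ab by (auto simp: uv grid_dist_def)
      then show ?thesis
        using c True es by (auto simp: uv intro!: exI[of _ c])
    next
      case False
      then have "a = a'"
        using step by simp
      \<comment> \<open>A vertical step shortens the distance only by entering the final row, so the
        rest of the walk stays in row \<open>l\<close> and the change happens at column
        \<open>a\<close>.\<close>
      moreover have "1 + grid_dist v (b, l) \<le> grid_dist u (b, l)"
        using dist tight by linarith
      ultimately have "a = a'" "l = j'"
        by (auto simp: uv grid_dist_def of_bool_def split: if_splits)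
      then show ?thesis
        using c es by (auto simp: uv intro!: exI[of _ a])
    qed
  qed
qed (simp add: vwalk_def)

section \<open>General position in terms of the two rows\<close>

definition row :: "(nat \<times> nat) set \<Rightarrow> nat \<Rightarrow> nat set" where
  "row S j = {i. (i, j) \<in> S}"

lemma card_inter_strip: "card (S \<inter> X \<times> {j}) = card (row S j \<inter> X)"
proof -
  have "S \<inter> X \<times> {j} = (\<lambda>i. (i, j)) ` (row S j \<inter> X)"
    by (auto simp: row_def)
  then show ?thesis
    by (simp add: card_image inj_on_def)
qed

text \<open>The vertical edge uses up one of the \<open>d\<close> edges, so a crossing path spans at
  most \<open>d\<close> columns, whence the strict \<open>b < a + d\<close>. Column \<open>c\<close>
  is counted in both rows because the path visits both of its vertices.\<close>

lemma general_position_crossing: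
  assumes "general_position_set k d (grid n) S"
    and "1 \<le> a" "a \<le> c" "c \<le> b" "b \<le> n" "b < a + d"
    and "j \<in> {1, 2}" "j' \<in> {1, 2}" "j \<noteq> j'"
  shows "card (row S j \<inter> {a..c}) + card (row S j' \<inter> {c..b}) < k"
proof -
  define p where "p = strip j a c @ strip j' c b"
  have "geodesic (grid n) p"
    unfolding p_def using assms by (intro geodesic_strip_append) auto
  moreover have "vwalk_length p \<le> d"
    using assms by (simp add: p_def strip_simps)
  ultimately have "card (S \<inter> set p) < k"
    using assms(1) by (meson general_position_set_def leI leD)
  moreover have "S \<inter> set p = (S \<inter> {a..c} \<times> {j}) \<union> (S \<inter> {c..b} \<times> {j'})"
    using assms by (auto simp: p_def strip_simps)
  moreover have "card \<dots> = card (S \<inter> {a..c} \<times> {j}) + card (S \<inter> {c..b} \<times> {j'})"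
    using assms by (intro card_Un_disjoint) auto
  ultimately show ?thesis
    by (simp add: card_inter_strip)
qed

text \<open>By \<open>tight_vwalk_cover\<close> a geodesic running to the right lies in one strip or
  in two strips meeting in a column, and its length bounds the columns spanned: \<open>d + 1\<close>
  if straight, \<open>d\<close> if crossing. Other geodesics are reversed first.\<close>

lemma general_position_setI_grid:
  assumes S: "S \<subseteq> {1..n} \<times> {1, 2}"
    and straight: "\<And>j a b. \<lbrakk>j \<in> {1, 2}; 1 \<le> a; a \<le> b; b \<le> n; b \<le> a + d\<rbrakk>
      \<Longrightarrow> card (row S j \<inter> {a..b}) < k"
    and crossing: "\<And>j j' a c b. \<lbrakk>j \<in> {1, 2}; j' \<in> {1, 2}; j \<noteq> j'; 1 \<le> a; a \<le> c; c \<le> b;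
      b \<le> n; b < a + d\<rbrakk> \<Longrightarrow> card (row S j \<inter> {a..c}) + card (row S j' \<inter> {c..b}) < k"
  shows "general_position_set k d (grid n) S"
  unfolding general_position_set_def
proof (intro conjI allI impI)
  show "S \<subseteq> verts (grid n)"
    using S by (simp add: grid2_def)
next
  have short: "card (S \<inter> set p) < k"
    if p: "geodesic (grid n) p" "vwalk_length p \<le> d" "fst (hd p) \<le> fst (last p)" for p
  proof -
    obtain a j b j' where ab: "hd p = (a, j)" "last p = (b, j')"
      by fastforce
    have walk: "vwalk p (grid n)"
      using p by (simp add: geodesic_def vpath_def)
    have "p \<noteq> []" and "set p \<subseteq> {1..n} \<times> {1, 2}"
      using walk by (auto simp: vwalk_def grid2_def)
    then have "hd p \<in> {1..n} \<times> {1, 2}" "last p \<in> {1..n} \<times> {1, 2}"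
      using hd_in_set last_in_set by blast+
    then have bounds: "1 \<le> a" "b \<le> n" "j \<in> {1, 2}" "j' \<in> {1, 2}"
      by (auto simp: ab)
    obtain c where c: "a \<le> c" "c \<le> b" "set p \<subseteq> {a..c} \<times> {j} \<union> {c..b} \<times> {j'}"
      using tight_vwalk_cover[OF walk p(3) geodesic_length_le[OF p(1,3)]] ab by auto
    have dist: "grid_dist (a, j) (b, j') \<le> int d"
      using grid_dist_le[OF walk] p(2) ab by simp
    show ?thesis
    proof (cases "j = j'")
      case True
      have "card (S \<inter> set p) \<le> card (S \<inter> {a..b} \<times> {j})"
        using c True by (intro card_mono) auto
      moreover have "b \<le> a + d"
        using dist c by (auto simp: grid_dist_def True)
      ultimately show ?thesis
        using straight[of j a b] bounds c by (simp add: card_inter_strip)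
    next
      case False
      have "card (S \<inter> set p) \<le> card ((S \<inter> {a..c} \<times> {j}) \<union> (S \<inter> {c..b} \<times> {j'}))"
        using c by (intro card_mono) auto
      also have "\<dots> \<le> card (S \<inter> {a..c} \<times> {j}) + card (S \<inter> {c..b} \<times> {j'})"
        by (rule card_Un_le)
      finally have "card (S \<inter> set p) \<le> card (row S j \<inter> {a..c}) + card (row S j' \<inter> {c..b})"
        by (simp add: card_inter_strip)
      moreover have "b < a + d"
        using dist c False by (auto simp: grid_dist_def)
      ultimately show ?thesis
        using crossing[of j j' a c b] bounds c False by simp
    qed
  qed
  fix p assume p: "geodesic (grid n) p \<and> k \<le> card (S \<inter> set p)"
  show "d < vwalk_length p"
  proof (cases "fst (hd p) \<le> fst (last p)")
    case True
    then show ?thesis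
      using short[of p] p by fastforce
  next
    case False
    have "p \<noteq> []"
      using p by (auto simp: geodesic_def vpath_def vwalk_def)
    then have "\<not> vwalk_length (rev p) \<le> d"
      using short[of "rev p"] geodesic_rev[OF symmetric_grid] p False
      by (auto simp: hd_rev last_rev simp del: vwalk_length_simp)
    then show ?thesis
      by simp
  qed
qed


lemma card_eq_card_rows:

  \<comment> \<open>Column weights and upper bounds\<close>
  assumes "S \<subseteq> {1..n} \<times> {1, 2}"
  shows "card S = card (row S 1 \<inter> {1..n}) + card (row S 2 \<inter> {1..n})"
proof -
  have "S = (S \<inter> {1..n} \<times> {1}) \<union> (S \<inter> {1..n} \<times> {2})"
    using assms by auto
  then have "card S = card ((S \<inter> {1..n} \<times> {1}) \<union> (S \<inter> {1..n} \<times> {2}))"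
    by simp
  also have "\<dots> = card (S \<inter> {1..n} \<times> {1}) + card (S \<inter> {1..n} \<times> {2})"
    by (intro card_Un_disjoint) auto
  finally show ?thesis
    by (simp add: card_inter_strip)
qed

definition column_weight :: "(nat \<times> nat) set \<Rightarrow> nat \<Rightarrow> nat" where
  "column_weight S i = of_bool (i \<in> row S 1) + of_bool (i \<in> row S 2)"

lemma column_weight_le: "column_weight S i \<le> 2"
  by (simp add: column_weight_def)

lemma sum_column_weight:
  assumes "finite X"
  shows "sum (column_weight S) X = card (row S 1 \<inter> X) + card (row S 2 \<inter> X)"
  using assms by (simp add: column_weight_def sum.distrib Int_def conj_commute)

lemma card_split_at:
  assumes "a \<le> c" "c \<le> (b :: nat)"
  shows "card (A \<inter> {a..c}) + card (A \<inter> {c..b}) = card (A \<inter> {a..b}) + of_bool (c \<in> A)"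
proof -
  have "(A \<inter> {a..c}) \<union> (A \<inter> {c..b}) = A \<inter> {a..b}"
    "(A \<inter> {a..c}) \<inter> (A \<inter> {c..b}) = (if c \<in> A then {c} else {})"
    using assms by auto
  then show ?thesis
    using card_Un_Int[of "A \<inter> {a..c}" "A \<inter> {c..b}"] by simp
qed

text \<open>The two crossing paths through \<open>c\<close> together meet each vertex of the window
  once and those of column \<open>c\<close> twice, and each carries at most \<open>k - 1\<close>
  vertices of \<open>S\<close>.\<close>

lemma window_weight:
  assumes S: "general_position_set k d (grid n) S"
    and "1 \<le> a" "a \<le> c" "c < a + m" "m \<le> d" "a + m \<le> n + 1"
  shows "sum (column_weight S) {a..<a + m} + column_weight S c \<le> 2 * k - 2"
proof -
  define b where "b = a + m - 1"
  have b: "{a..<a + m} = {a..b}" "c \<le> b" "b \<le> n" "b < a + d"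
    using assms by (auto simp: b_def)
  have "card (row S 1 \<inter> {a..c}) + card (row S 2 \<inter> {c..b}) < k"
    "card (row S 2 \<inter> {a..c}) + card (row S 1 \<inter> {c..b}) < k"
    using assms b by (auto intro!: general_position_crossing[OF S])
  moreover have "sum (column_weight S) {a..<a + m}
      = card (row S 1 \<inter> {a..b}) + card (row S 2 \<inter> {a..b})"
    unfolding b(1) by (rule sum_column_weight) simp
  ultimately show ?thesis
    using card_split_at[of a c b "row S 1"] card_split_at[of a c b "row S 2"] assms(3) b(2)
    unfolding column_weight_def[of S c] by linarith
qed

text \<open>Apply \<open>window_weight\<close> at an occupied column, which contributes at least one
  extra.\<close>

lemma window_weight_le:
  assumes S: "general_position_set k d (grid n) S"
    and "1 \<le> a" "m \<le> d" "a + m \<le> n + 1" "k \<ge> 2"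
  shows "sum (column_weight S) {a..<a + m} \<le> 2 * k - 3"
proof (cases "\<exists>c \<in> {a..<a + m}. column_weight S c \<noteq> 0")
  case True
  then obtain c where "a \<le> c" "c < a + m" "column_weight S c \<noteq> 0"
    by auto
  then show ?thesis
    using window_weight[OF S, of a c m] assms by simp
next
  case False
  then have "sum (column_weight S) {a..<a + m} = 0"
    by (intro sum.neutral) auto
  then show ?thesis
    by simp
qed

text \<open>A column meeting \<open>S\<close> twice costs its window one vertex, so a window of the maximal weight
  \<open>2 * k - 3\<close> meets \<open>S\<close> at most once per column.\<close>

lemma column_weight_le_one:
  assumes S: "general_position_set k d (grid n) S"
    and "1 \<le> a" "m \<le> d" "a + m \<le> n + 1"
    and "sum (column_weight S) {a..<a + m} > 2 * k - 4"
    and "a \<le> c" "c < a + m"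
  shows "column_weight S c \<le> 1"
  using window_weight[OF S, of a c m] assms by simp

text \<open>A weight above \<open>2 * k - 4\<close> would force at most one vertex per column, hence
  weight at most \<open>m\<close>, which is too small. The bound \<open>2 * m\<close> is
  trivial.\<close>

lemma short_window_weight_le:
  assumes S: "general_position_set k d (grid n) S"
    and "1 \<le> a" "m \<le> d" "a + m \<le> n + 1" "m < 2 * k - 3"
  shows "sum (column_weight S) {a..<a + m} \<le> 2 * min m (k - 2)"
proof -
  have "sum (column_weight S) {a..<a + m} \<le> (\<Sum>c\<in>{a..<a + m}. 2)"
    by (intro sum_mono column_weight_le)
  moreover have "sum (column_weight S) {a..<a + m} \<le> 2 * k - 4"
  proof (rule ccontr)
    assume large: "\<not> ?thesis"
    have "sum (column_weight S) {a..<a + m} \<le> (\<Sum>c\<in>{a..<a + m}. 1)"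
      using column_weight_le_one[OF S] assms large by (intro sum_mono) auto
    then show False
      using assms large by simp
  qed
  ultimately show ?thesis
    by simp
qed

lemma sum_blocks_le:
  fixes f :: "nat \<Rightarrow> nat"
  assumes "\<And>t. t < m \<Longrightarrow> sum f {s + t * d..<s + t * d + d} \<le> M"
  shows "sum f {s..<s + m * d} \<le> m * M"
  using assms
proof (induction m)
  case (Suc m)
  have "sum f {s..<s + Suc m * d} = sum f {s..<s + m * d} + sum f {s + m * d..<s + m * d + d}"
    by (subst sum.atLeastLessThan_concat) (auto simp: add_ac)
  also have "\<dots> \<le> m * M + M"
    using Suc by (intro add_mono) auto
  finally show ?case
    by simp
qed simp

lemma card_eq_sum_column_weight:
  assumes "general_position_set k d (grid n) S"
  shows "card S = sum (column_weight S) {1..<1 + n}"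
proof -
  have "S \<subseteq> {1..n} \<times> {1, 2}"
    using assms by (simp add: general_position_set_def grid2_def)
  moreover have "{1..<1 + n} = {1..n}"
    by auto
  ultimately show ?thesis
    by (simp add: card_eq_card_rows sum_column_weight)
qed

lemma card_le_short:
  assumes S: "general_position_set k d (grid (q * d + r)) S"
    and "r \<le> d" "d < 2 * k - 3"
  shows "card S \<le> q * (2 * k - 4) + 2 * min r (k - 2)"
proof -
  have "sum (column_weight S) {1..<1 + q * d} \<le> q * (2 * k - 4)"
  proof (rule sum_blocks_le)
    fix t assume "t < q"
    then have "t * d + d \<le> q * d"
      by (metis Suc_leI add.commute mult_Suc mult_le_mono1)
    then show "sum (column_weight S) {1 + t * d..<1 + t * d + d} \<le> 2 * k - 4"
      using short_window_weight_le[OF S, of "1 + t * d" d] assms by simp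
  qed
  moreover have "sum (column_weight S) {1 + q * d..<1 + q * d + r} \<le> 2 * min r (k - 2)"
    using assms by (intro short_window_weight_le[OF S]) auto
  moreover have "card S
      = sum (column_weight S) {1..<1 + q * d} + sum (column_weight S) {1 + q * d..<1 + q * d + r}"
    unfolding card_eq_sum_column_weight[OF S]
    by (subst sum.atLeastLessThan_concat) auto
  ultimately show ?thesis
    by linarith
qed

text \<open>The remainder block can be placed before any of the \<open>q\<close> blocks of length \<open>d\<close>, or at the end.
  If the blocks at multiples of \<open>d\<close> do not all have weight at most \<open>2 * k - 4\<close>, it is put at the
  start of a block of maximal weight, where all columns have weight at most one.\<close>

lemma card_le_long:
  assumes S: "general_position_set k d (grid (q * d + r)) S"
    and "r \<le> d" "2 \<le> k"
  shows "card S \<le> max (q * (2 * k - 3) + min r (2 * k - 3)) (q * (2 * k - 4) + 2 * min r (k - 2))"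
proof -
  define f where "f = column_weight S"
  define n where "n = q * d + r"
  note S = S[folded n_def]
  have block_le: "t * d + d \<le> q * d" if "t < q" for t
    using that by (metis Suc_leI add.commute mult_Suc mult_le_mono1)
  \<comment> \<open>Here \<open>j\<close> counts the full blocks to the left of the remainder block;
    those to its right are shifted by \<open>r\<close>.\<close>
  have split: "card S = sum f {1..<1 + j * d} + sum f {1 + j * d..<1 + j * d + r}
      + sum f {1 + j * d + r..<1 + j * d + r + (q - j) * d}" if "j \<le> q" for j
  proof -
    have "n = j * d + r + (q - j) * d"
      using that unfolding n_def by (metis add.assoc add.commute add_mult_distrib le_add_diff_inverse)
    then have "{1..<1 + n} = {1..<1 + j * d + r + (q - j) * d}"
      by (simp add: add_ac)
    then show ?thesis
      unfolding card_eq_sum_column_weight[OF S] f_def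
      by (simp add: sum.atLeastLessThan_concat del: add_Suc)
  qed
  \<comment> \<open>All full blocks get the general window bound, so that only the position of the
    remainder block is left to choose.\<close>
  have max_total: "card S \<le> q * (2 * k - 3) + sum f {1 + j * d..<1 + j * d + r}" if "j \<le> q" for j
  proof -
    have "sum f {1..<1 + j * d} \<le> j * (2 * k - 3)"
    proof (rule sum_blocks_le)
      fix t assume "t < j"
      then show "sum f {1 + t * d..<1 + t * d + d} \<le> 2 * k - 3"
        unfolding f_def using block_le[of t] assms that
        by (intro window_weight_le[OF S]) (auto simp: n_def)
    qed
    moreover have "sum f {1 + j * d + r..<1 + j * d + r + (q - j) * d} \<le> (q - j) * (2 * k - 3)"
    proof (rule sum_blocks_le)
      fix t assume "t < q - j"
      then have "(j + t) * d + d \<le> q * d"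
        using that by (intro block_le) simp
      then show "sum f {1 + j * d + r + t * d..<1 + j * d + r + t * d + d} \<le> 2 * k - 3"
        unfolding f_def using assms
        by (intro window_weight_le[OF S]) (auto simp: n_def add_mult_distrib)
    qed
    moreover have "j * (2 * k - 3) + (q - j) * (2 * k - 3) = q * (2 * k - 3)"
      using that by (metis add_mult_distrib le_add_diff_inverse)
    ultimately show ?thesis
      using split[OF that] by linarith
  qed
  show ?thesis
  proof (cases "r < 2 * k - 3")
    case False
    have "sum f {1 + q * d..<1 + q * d + r} \<le> 2 * k - 3"
      unfolding f_def using assms by (intro window_weight_le[OF S]) (auto simp: n_def)
    then show ?thesis
      using max_total[of q] False by simp
  next
    case r: True
    show ?thesis
    proof (cases "\<exists>t<q. sum f {1 + t * d..<1 + t * d + d} > 2 * k - 4")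
      case True
      then obtain t where t: "t < q" "sum f {1 + t * d..<1 + t * d + d} > 2 * k - 4"
        by auto
      have "f c \<le> 1" if "c \<in> {1 + t * d..<1 + t * d + r}" for c
        using column_weight_le_one[OF S, of "1 + t * d" d c] t that block_le[of t] assms
        by (auto simp: f_def n_def)
      then have "sum f {1 + t * d..<1 + t * d + r} \<le> (\<Sum>c\<in>{1 + t * d..<1 + t * d + r}. 1)"
        by (rule sum_mono)
      then show ?thesis
        using max_total[of t] t r by simp
    next
      case False
      then have "sum f {1..<1 + q * d} \<le> q * (2 * k - 4)"
        by (intro sum_blocks_le) (meson not_less)
      moreover have "sum f {1 + q * d..<1 + q * d + r} \<le> 2 * min r (k - 2)"
        unfolding f_def using assms r by (intro short_window_weight_le[OF S]) (auto simp: n_def)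
      moreover have "card S = sum f {1..<1 + q * d} + sum f {1 + q * d..<1 + q * d + r}"
        using split[of q] by simp
      ultimately show ?thesis
        by (intro max.coboundedI2) linarith
    qed
  qed
qed

section \<open>Periodic constructions\<close>

text \<open>The first \<open>m\<close> columns of each period of length \<open>d\<close>; the shift
  \<open>i - 1\<close> is there because columns are numbered from 1.\<close>

definition periodic_columns :: "nat \<Rightarrow> nat \<Rightarrow> nat \<Rightarrow> nat set" where
  "periodic_columns d m n = {i \<in> {1..n}. (i - 1) mod d < m}"

lemma card_periodic_columns:
  assumes "d > 0" "m \<le> d"
  shows "card (periodic_columns d m n) = n div d * m + min (n mod d) m"
proof (induction n)
  case (Suc n)
  have "periodic_columns d m (Suc n)
      = (if n mod d < m then insert (Suc n) (periodic_columns d m n) else periodic_columns d m n)"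
    by (auto simp: periodic_columns_def le_Suc_eq)
  moreover have "Suc n \<notin> periodic_columns d m n" "finite (periodic_columns d m n)"
    by (simp_all add: periodic_columns_def)
  moreover have "n mod d < d"
    using assms by simp
  ultimately show ?case
    using Suc assms by (auto simp: div_Suc mod_Suc min_def)
qed (simp add: periodic_columns_def)

text \<open>At most \<open>d\<close> consecutive columns have distinct residues modulo
  \<open>d\<close>, and only the residues below \<open>m\<close> are selected.\<close>

lemma card_periodic_window:
  assumes "a \<ge> 1" "b < a + d"
  shows "card (periodic_columns d m n \<inter> {a..b}) \<le> m"
proof -
  have eq: "x = y" if "x \<le> y" "x \<in> {a..b}" "y \<in> {a..b}" "(x - 1) mod d = (y - 1) mod d" for x y
  proof (rule ccontr)
    assume "x \<noteq> y"
    have "d dvd (y - 1) - (x - 1)"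
      using that by (metis diff_le_mono mod_eq_dvd_iff_nat)
    then have "d \<le> (y - 1) - (x - 1)"
      using that assms \<open>x \<noteq> y\<close> by (intro dvd_imp_le) auto
    then show False
      using that assms by auto
  qed
  have "inj_on (\<lambda>i. (i - 1) mod d) (periodic_columns d m n \<inter> {a..b})"
    by (rule inj_onI) (metis IntD2 eq nat_le_linear)
  moreover have "(\<lambda>i. (i - 1) mod d) ` (periodic_columns d m n \<inter> {a..b}) \<subseteq> {..<m}"
    by (auto simp: periodic_columns_def)
  ultimately have "card (periodic_columns d m n \<inter> {a..b}) \<le> card {..<m}"
    by (rule card_inj_on_le) simp
  then show ?thesis
    by simp
qed

text \<open>Bridges the gap between windows of \<open>d\<close> columns and straight geodesics,
  which may span \<open>d + 1\<close>.\<close>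

lemma card_Int_long_window:
  assumes "card (F \<inter> {a..b - 1}) \<le> m"
  shows "card (F \<inter> {a..b :: nat}) \<le> Suc m"
proof -
  have "card (F \<inter> {a..b}) \<le> card (insert b (F \<inter> {a..b - 1}))"
    by (intro card_mono) auto
  also have "\<dots> \<le> Suc (card (F \<inter> {a..b - 1}))"
    by (rule card_insert_le_m1) auto
  finally show ?thesis
    using assms by simp
qed

text \<open>Both kinds of geodesic gain at most one over the window bound \<open>k - 2\<close>: a
  straight one by its additional column, a crossing one by meeting column \<open>c\<close>
  twice.\<close>

lemma full_columns_general_position:
  assumes F: "F \<subseteq> {1..n}" and "k \<ge> 2"
    and window: "\<And>a b. a \<ge> 1 \<Longrightarrow> b < a + d \<Longrightarrow> card (F \<inter> {a..b}) \<le> k - 2"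
  shows "general_position_set k d (grid n) (F \<times> {1, 2})"
proof (rule general_position_setI_grid)
  show "F \<times> {1, 2} \<subseteq> {1..n} \<times> {1, 2}"
    using F by auto
  have row: "row (F \<times> {1, 2}) j = F" if "j \<in> {1, 2}" for j
    using that by (auto simp: row_def)
  show "card (row (F \<times> {1, 2}) j \<inter> {a..b}) < k"
    if "j \<in> {1, 2}" "1 \<le> a" "a \<le> b" "b \<le> n" "b \<le> a + d" for j a b
  proof (cases "b = 0")
    case False
    then have "card (F \<inter> {a..b - 1}) \<le> k - 2"
      using that by (cases "d = 0") (auto intro!: window)
    then show ?thesis
      unfolding row[OF that(1)] using card_Int_long_window[of F a b "k - 2"] \<open>k \<ge> 2\<close> by simp
  qed (use that in simp)
  show "card (row (F \<times> {1, 2}) j \<inter> {a..c}) + card (row (F \<times> {1, 2}) j' \<inter> {c..b}) < k"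
    if "j \<in> {1, 2}" "j' \<in> {1, 2}" "1 \<le> a" "a \<le> c" "c \<le> b" "b < a + d" for j j' a c b
    unfolding row[OF that(1)] row[OF that(2)]
    using card_split_at[of a c b F] window[of a b] that \<open>k \<ge> 2\<close> by (cases "c \<in> F") simp_all
qed

text \<open>The parity of the number of earlier columns of \<open>F\<close> makes the chosen
  vertices alternate between the rows, beginning in row 1.\<close>

definition alternating_set :: "nat set \<Rightarrow> (nat \<times> nat) set" where
  "alternating_set F = (\<lambda>i. (i, if even (card (F \<inter> {..<i})) then 1 else 2)) ` F"

lemma card_Int_lessThan_Suc:
  "card (A \<inter> {..<Suc i}) = card (A \<inter> {..<i}) + of_bool (i \<in> A)"
proof -
  have "A \<inter> {..<Suc i} = (if i \<in> A then insert i (A \<inter> {..<i}) else A \<inter> {..<i})"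
    by (auto simp: less_Suc_eq)
  then show ?thesis
    by simp
qed

lemma row_alternating_set:
  "row (alternating_set F) 1 = {i \<in> F. even (card (F \<inter> {..<i}))}"
  "row (alternating_set F) 2 = {i \<in> F. odd (card (F \<inter> {..<i}))}"
  by (auto simp: row_def alternating_set_def split: if_splits)

text \<open>Row 1 comes first and so receives the larger half. This reduces all counts in the rows
  to halves of prefix counts of \<open>F\<close>.\<close>

lemma card_row_alternating_set:
  "card (row (alternating_set F) 1 \<inter> {..<i}) = (card (F \<inter> {..<i}) + 1) div 2 \<and>
   card (row (alternating_set F) 2 \<inter> {..<i}) = card (F \<inter> {..<i}) div 2"
proof (induction i)
  case (Suc i)
  have "i \<in> row (alternating_set F) 1 \<longleftrightarrow> i \<in> F \<and> even (card (F \<inter> {..<i}))"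
    "i \<in> row (alternating_set F) 2 \<longleftrightarrow> i \<in> F \<and> odd (card (F \<inter> {..<i}))"
    unfolding row_alternating_set by simp_all
  then show ?case
    using Suc unfolding card_Int_lessThan_Suc
    by (cases "i \<in> F"; cases "even (card (F \<inter> {..<i}))") (auto elim!: evenE oddE)
qed simp

lemma card_Int_atLeastAtMost:
  assumes "a \<le> Suc b"
  shows "card (A \<inter> {..<Suc b}) = card (A \<inter> {..<a}) + card (A \<inter> {a..b})"
proof -
  have "A \<inter> {..<Suc b} = (A \<inter> {..<a}) \<union> (A \<inter> {a..b})"
    using assms by auto
  then show ?thesis
    by (simp add: card_Un_disjoint disjoint_iff)
qed

text \<open>A straight geodesic meets at most \<open>2 * k - 2\<close> columns of \<open>F\<close>,
  every second of them in its own row. For a crossing geodesic the prefix counts nearly telescope,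
  and the rounding at the ends and at \<open>c\<close> has to be balanced.\<close>

lemma alternating_set_general_position:
  assumes F: "F \<subseteq> {1..n}" and "k \<ge> 2"
    and window: "\<And>a b. a \<ge> 1 \<Longrightarrow> b < a + d \<Longrightarrow> card (F \<inter> {a..b}) \<le> 2 * k - 3"
  shows "general_position_set k d (grid n) (alternating_set F)"
proof (rule general_position_setI_grid)
  show "alternating_set F \<subseteq> {1..n} \<times> {1, 2}"
    using F by (auto simp: alternating_set_def)
  define R where "R = row (alternating_set F)"
  define N where "N i = card (F \<inter> {..<i})" for i
  have R1: "card (R 1 \<inter> {..<i}) = (N i + 1) div 2" and R2: "card (R 2 \<inter> {..<i}) = N i div 2" for i
    unfolding R_def N_def using card_row_alternating_set by blast+
  show "card (row (alternating_set F) j \<inter> {a..b}) < k"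
    if "j \<in> {1, 2}" "1 \<le> a" "a \<le> b" "b \<le> n" "b \<le> a + d" for j a b
  proof -
    have "card (F \<inter> {a..b - 1}) \<le> 2 * k - 3"
      using that by (cases "d = 0") (auto intro!: window)
    then have "N (Suc b) \<le> N a + (2 * k - 2)"
      using card_Int_long_window[of F a b "2 * k - 3"] card_Int_atLeastAtMost[of a b F] that \<open>k \<ge> 2\<close>
      by (simp add: N_def)
    moreover have "card (R j \<inter> {..<Suc b}) = card (R j \<inter> {..<a}) + card (R j \<inter> {a..b})"
      using that by (intro card_Int_atLeastAtMost) simp
    ultimately have "card (R j \<inter> {a..b}) < k"
      using that(1) R1[of a] R1[of "Suc b"] R2[of a] R2[of "Suc b"] \<open>k \<ge> 2\<close> by auto
    then show ?thesis
      by (simp add: R_def)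
  qed
  show "card (row (alternating_set F) j \<inter> {a..c}) + card (row (alternating_set F) j' \<inter> {c..b}) < k"
    if "j \<in> {1, 2}" "j' \<in> {1, 2}" "j \<noteq> j'" "1 \<le> a" "a \<le> c" "c \<le> b" "b < a + d"
    for j j' a c b
  proof -
    have N_step: "N (Suc c) \<le> N c + 1"
      unfolding N_def by (simp add: card_Int_lessThan_Suc)
    have N_window: "N (Suc b) \<le> N a + (2 * k - 3)"
      using window[of a b] card_Int_atLeastAtMost[of a b F] that by (simp add: N_def)
    have rows: "j = 1 \<and> j' = 2 \<or> j = 2 \<and> j' = 1"
      using that(1-3) by auto
    have "card (R j \<inter> {..<Suc c}) = card (R j \<inter> {..<a}) + card (R j \<inter> {a..c})"
      "card (R j' \<inter> {..<Suc b}) = card (R j' \<inter> {..<c}) + card (R j' \<inter> {c..b})"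
      using that by (auto intro!: card_Int_atLeastAtMost)
    then consider
        "(N (Suc c) + 1) div 2 = (N a + 1) div 2 + card (R j \<inter> {a..c})"
        "N (Suc b) div 2 = N c div 2 + card (R j' \<inter> {c..b})"
      | "N (Suc c) div 2 = N a div 2 + card (R j \<inter> {a..c})"
        "(N (Suc b) + 1) div 2 = (N c + 1) div 2 + card (R j' \<inter> {c..b})"
      using rows by (elim disjE conjE) (simp_all only: R1 R2)
    then have "card (R j \<inter> {a..c}) + card (R j' \<inter> {c..b}) < k"
    proof cases
      case 1
      \<comment> \<open>Starting in row 1, the path may gain one at the turn, but rounding at the
        two ends leaves at most \<open>k - 2\<close> for the rest.\<close>
      have "(N (Suc c) + 1) div 2 \<le> N c div 2 + 1"
        using N_step by linarith
      moreover have "N (Suc b) div 2 + 1 < (N a + 1) div 2 + k"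
        using N_window \<open>k \<ge> 2\<close> by linarith
      ultimately show ?thesis
        using 1 by linarith
    next
      case 2
      \<comment> \<open>Starting in row 2, the turn gains nothing, while the ends may contribute
        \<open>k - 1\<close>.\<close>
      have "N (Suc c) div 2 \<le> (N c + 1) div 2"
        using N_step by linarith
      moreover have "(N (Suc b) + 1) div 2 < N a div 2 + k"
        using N_window \<open>k \<ge> 2\<close> by linarith
      ultimately show ?thesis
        using 2 by linarith
    qed
    then show ?thesis
      by (simp add: R_def)
  qed
qed

section \<open>Values of \<open>gp\<close>\<close>

lemma gp_eqI:
  assumes "\<And>S. general_position_set k d (grid n) S \<Longrightarrow> card S \<le> N"
    and "general_position_set k d (grid n) T" "card T = N"
  shows "gp k d (grid n) = N"
  unfolding gp_def
proof (rule Max_eqI)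
  show "finite (card ` {S. general_position_set k d (grid n) S})"
    by (intro finite_imageI finite_general_position_sets) (simp add: grid2_def)
qed (use assms in auto)

lemma full_columns_attained:
  assumes "d > 0" "k \<ge> 2" "k - 2 \<le> d"
  shows "\<exists>T. general_position_set k d (grid n) T
    \<and> card T = n div d * (2 * k - 4) + 2 * min (n mod d) (k - 2)"
proof (intro exI conjI)
  define F where "F = periodic_columns d (k - 2) n"
  show "general_position_set k d (grid n) (F \<times> {1, 2})"
    using assms unfolding F_def
    by (intro full_columns_general_position card_periodic_window)
      (auto simp: periodic_columns_def)
  have "2 * k - 4 = 2 * (k - 2)"
    by simp
  then show "card (F \<times> {1 :: nat, 2}) = n div d * (2 * k - 4) + 2 * min (n mod d) (k - 2)"
    using assms by (simp add: F_def card_cartesian_product card_periodic_columns)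
qed

lemma alternating_set_attained:
  assumes "d > 0" "k \<ge> 2" "2 * k - 3 \<le> d"
  shows "\<exists>T. general_position_set k d (grid n) T
    \<and> card T = n div d * (2 * k - 3) + min (n mod d) (2 * k - 3)"
proof (intro exI conjI)
  define F where "F = periodic_columns d (2 * k - 3) n"
  show "general_position_set k d (grid n) (alternating_set F)"
    using assms unfolding F_def
    by (intro alternating_set_general_position card_periodic_window)
      (auto simp: periodic_columns_def)
  have "card (alternating_set F) = card F"
    unfolding alternating_set_def by (intro card_image) (simp add: inj_on_def)
  then show "card (alternating_set F) = n div d * (2 * k - 3) + min (n mod d) (2 * k - 3)"
    using assms by (simp add: F_def card_periodic_columns)
qed

lemma gp_grid_short:
  assumes "d > 0" "k \<ge> 2" "k - 2 \<le> d" "d < 2 * k - 3"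
  shows "gp k d (grid n) = n div d * (2 * k - 4) + 2 * min (n mod d) (k - 2)"
proof -
  obtain T where "general_position_set k d (grid n) T"
    "card T = n div d * (2 * k - 4) + 2 * min (n mod d) (k - 2)"
    using full_columns_attained assms by blast
  moreover have "n mod d \<le> d"
    using assms by (simp add: less_imp_le)
  ultimately show ?thesis
    using card_le_short[of k d "n div d" "n mod d"] assms by (intro gp_eqI) auto
qed

text \<open>Once \<open>2 * k - 3\<close> columns fit into a period, both constructions are
  available, and their sizes are exactly the two terms of \<open>card_le_long\<close>.\<close>

lemma gp_grid_long:
  assumes "d > 0" "k \<ge> 2" "2 * k - 3 \<le> d"
  shows "gp k d (grid n) = max (n div d * (2 * k - 3) + min (n mod d) (2 * k - 3))
    (n div d * (2 * k - 4) + 2 * min (n mod d) (k - 2))" (is "_ = max ?x ?y")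
proof -
  have "\<exists>T. general_position_set k d (grid n) T \<and> card T = ?x"
    "\<exists>T. general_position_set k d (grid n) T \<and> card T = ?y"
    using assms alternating_set_attained[of d k n] full_columns_attained[of d k n] by auto
  then obtain T where "general_position_set k d (grid n) T" "card T = max ?x ?y"
    unfolding max_def by metis
  moreover have "card S \<le> max ?x ?y" if "general_position_set k d (grid n) S" for S
  proof (rule card_le_long)
    show "general_position_set k d (grid (n div d * d + n mod d)) S"
      unfolding div_mult_mod_eq by (rule that)
  qed (use assms in \<open>simp_all add: less_imp_le\<close>)
  ultimately show ?thesis
    by (intro gp_eqI)
qed

theorem theorem6p8:
  fixes d k n q r :: nat
  assumes "d > 0" and "n > 0" and "k \<ge> 4" and "d \<ge> k - 1"
    and "q = n div d" and "r = n mod d"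
  shows
    "(n \<le> d \<longrightarrow>
        (1 \<le> n \<and> n \<le> 2 * k - 4 \<longrightarrow> gp k d (with_proj (grid2 n)) = 2 * min n (k - 2)) \<and>
        (n \<ge> 2 * k - 3 \<longrightarrow> gp k d (with_proj (grid2 n)) = 2 * k - 3)) \<and>
     (n \<ge> d + 1 \<and> d < 2 * k - 3 \<longrightarrow>
        gp k d (with_proj (grid2 n)) = (2 * k - 4) * q + 2 * min r (k - 2)) \<and>
     (n \<ge> d + 1 \<and> d \<ge> 2 * k - 3 \<longrightarrow>
        (r \<le> k - 2 \<longrightarrow>
           (r \<le> q \<longrightarrow> gp k d (with_proj (grid2 n)) = (2 * k - 3) * q + r) \<and>
           (r > q \<longrightarrow> gp k d (with_proj (grid2 n)) = (2 * k - 4) * q + 2 * r)) \<and>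
        (k - 2 < r \<and> r < 2 * k - 3 \<longrightarrow>
           (2 * k - 4 - r \<le> q \<longrightarrow> gp k d (with_proj (grid2 n)) = (2 * k - 3) * q + r) \<and>
           (2 * k - 4 - r > q \<longrightarrow> gp k d (with_proj (grid2 n)) = (2 * k - 4) * (q + 1))) \<and>
        (r \<ge> 2 * k - 3 \<longrightarrow> gp k d (with_proj (grid2 n)) = (2 * k - 3) * (q + 1)))"

proof (cases "d < 2 * k - 3")
  case True
  have "gp k d (grid n) = (2 * k - 4) * q + 2 * min r (k - 2)"
    unfolding assms(5,6) using gp_grid_short[of d k n] assms(1,3,4) True
    by (simp add: mult.commute[of "n div d"])
  \<comment> \<open>The boundary \<open>n = d\<close> is a full block without remainder; since
    \<open>k - 2 < d\<close>, its value \<open>2 * k - 4\<close> agrees with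
    \<open>2 * min n (k - 2)\<close>.\<close>
  moreover have "q = 0 \<and> r = n \<or> q = 1 \<and> r = 0 \<and> n = d" if "n \<le> d"
    using that assms by (cases "n = d") auto
  ultimately show ?thesis
    using True assms(3,4) by (auto simp: min_def)
next
  case False
  have long: "gp k d (grid n)
      = max ((2 * k - 3) * q + min r (2 * k - 3)) ((2 * k - 4) * q + 2 * min r (k - 2))"
    unfolding assms(5,6) using gp_grid_long[of d k n] assms(1,3) False
    by (simp add: mult.commute[of "n div d"])
  have "2 * k - 3 = (2 * k - 4) + 1"
    using assms(3) by simp
  then have eq: "(2 * k - 3) * q = (2 * k - 4) * q + q"
    by (metis add_mult_distrib mult_1)
  have gp_eq: "gp k d (grid n)
      = (2 * k - 4) * q + max (q + min r (2 * k - 3)) (2 * min r (k - 2))"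
    unfolding long eq by (simp only: nat_add_max_right add.assoc)
  \<comment> \<open>After splitting off the common \<open>(2 * k - 4) * q\<close>, the cases of the
    claim only record which of the two constructions is larger.\<close>
  define M where "M = max (q + min r (2 * k - 3)) (2 * min r (k - 2))"
  have M: "r \<le> k - 2 \<Longrightarrow> r \<le> q \<Longrightarrow> M = q + r"
    "r \<le> k - 2 \<Longrightarrow> q < r \<Longrightarrow> M = 2 * r"
    "k - 2 < r \<Longrightarrow> r < 2 * k - 3 \<Longrightarrow> 2 * k - 4 - r \<le> q \<Longrightarrow> M = q + r"
    "k - 2 < r \<Longrightarrow> r < 2 * k - 3 \<Longrightarrow> q < 2 * k - 4 - r \<Longrightarrow> M = 2 * k - 4"
    "2 * k - 3 \<le> r \<Longrightarrow> M = q + (2 * k - 3)"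
    using assms(3) unfolding M_def by linarith+
  have gp_M: "gp k d (grid n) = (2 * k - 4) * q + M"
    unfolding gp_eq M_def ..
  show ?thesis
  proof (cases "n \<le> d")
    case True
    then consider "q = 0" "r = n" | "q = 1" "r = 0" "n = d"
      using assms by (cases "n = d") auto
    then show ?thesis
    proof cases
      case 1
      then have "gp k d (grid n) = M"
        using gp_M by simp
      moreover have "n \<le> 2 * k - 4 \<Longrightarrow> M = 2 * min n (k - 2)" "2 * k - 3 \<le> n \<Longrightarrow> M = 2 * k - 3"
        using assms(3) unfolding M_def 1 by linarith+
      ultimately show ?thesis
        using True by simp
    next
      case 2
      \<comment> \<open>For \<open>n = d\<close> the alternating construction wins by one, turning
        \<open>2 * k - 4\<close> into \<open>2 * k - 3\<close>.\<close>
      then have "M = 1"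
        using M(1) by simp
      then have "gp k d (grid n) = 2 * k - 3"
        using gp_M 2 assms(3) by simp
      then show ?thesis
        using True False 2 by auto
    qed
  next
    case n: False
    then show ?thesis
      using False assms(3) M
      unfolding gp_M eq add_mult_distrib2 mult_1_right by auto
  qed
qed

end
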